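(* Let $p\ge 1$, let $\Gamma$ be a non-degenerate (invertible) real $p\times p$ matrix, so that $L=\{k\Gamma : k\in\mathbb{Z}^p\}$ is a full rank discrete lattice in $\mathbb{R}^p$, and let $F=(F_1,\dots,F_p):\mathbb{R}^p\to\mathbb{R}^p$ be a mapping all of whose components $F_j$ are almost periodic functions on $\mathbb{R}^p$. Then the multiple discrete set $$A=(a_k)_{k\in\mathbb{Z}^p},\qquad a_k=k\Gamma+F(k),$$ is an almost periodic multiple discrete set in $\mathbb{R}^p$.
   Context: A continuous function $f$ on $\mathbb{R}^p$ is almost periodic if for every $\varepsilon>0$ the set $\{\tau\in\mathbb{R}^p:\sup_{x\in\mathbb{R}^p}|f(x+\tau)-f(x)|<\varepsilon\}$ is relatively dense in $\mathbb{R}^p$, i.e. there is $R=R(\varepsilon)<\infty$ such that every ball of radius $R$ contains an element of this set. A (signed) Borel measure $\mu$ on $\mathbb{R}^p$ is almost periodic (in the weak sense) if for every continuous compactly supported function $\varphi$ on $\mathbb{R}^p$ the function $x\mapsto\int\varphi(x+t)\,d\mu(t)$ is almost periodic on $\mathbb{R}^p$. A multiple discrete set $A=\{(x,m(x))\}$ in $\mathbb{R}^p$ is a discrete (locally finite) set $s(A)\subset\mathbb{R}^p$ together with a multiplicity $m(x)\in\mathbb{N}=\{1,2,\dots\}$ for each $x\in s(A)$. It is also written as an indexed family $A=(a_k)$ in which every $a\in s(A)$ appears exactly $m(a)$ times. $A$ is called almost periodic if its associated measure $\mu_A=\sum_{x\in s(A)}m(x)\delta_x$ is almost periodic, where $\delta_x$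 is the unit mass at $x$. Vectors in $\mathbb{R}^p$ and $\mathbb{Z}^p$ are row vectors, so $k\Gamma$ is the row-vector-matrix product. *)

theory Defs
  imports "HOL-Analysis.Analysis"
begin

definition relatively_dense :: "'a::euclidean_space set \<Rightarrow> bool" where
  "relatively_dense T \<longleftrightarrow> (\<exists>R::real. \<forall>c. \<exists>\<tau>\<in>T. \<tau> \<in> ball c R)"

text \<open>The supremum is taken in the extended reals, so that it is \<open>\<infinity>\<close> (and not an
  unspecified real number) when the difference is unbounded.\<close>

definition almost_periodic :: "('a::euclidean_space \<Rightarrow> real) \<Rightarrow> bool" where
  "almost_periodic f \<longleftrightarrow> continuous_on UNIV f \<and>
     (\<forall>\<epsilon>::real. \<epsilon> > 0 \<longrightarrow>
        relatively_dense {\<tau>. (SUP x. ereal \<bar>f (x + \<tau>) - f x\<bar>) < ereal \<epsilon>})"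

text \<open>Borel measures on \<open>\<real>\<^sup>p\<close> are understood to be finite on compact sets, which makes the
  integrals below exist. Only nonnegative measures are covered: these include the
  measures of multiple discrete sets.\<close>

definition almost_periodic_measure :: "'a::euclidean_space measure \<Rightarrow> bool" where
  "almost_periodic_measure \<mu> \<longleftrightarrow>
     sets \<mu> = sets borel \<and>
     (\<forall>K. compact K \<longrightarrow> emeasure \<mu> K < \<infinity>) \<and>
     (\<forall>\<phi> :: 'a \<Rightarrow> real. continuous_on UNIV \<phi> \<and> compact (closure {x. \<phi> x \<noteq> 0}) \<longrightarrow>
        almost_periodic (\<lambda>x. \<integral>t. \<phi> (x + t) \<partial>\<mu>))"

text \<open>A multiple discrete set is given by its support \<open>S\<close> and its multiplicity function
  \<open>m\<close>, of which only the values on \<open>S\<close> matter.\<close>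

definition multiple_discrete_set :: "'a::euclidean_space set \<Rightarrow> ('a \<Rightarrow> nat) \<Rightarrow> bool" where
  "multiple_discrete_set S m \<longleftrightarrow> (\<forall>c r. finite (S \<inter> ball c r)) \<and> (\<forall>x\<in>S. m x \<ge> 1)"

definition represents_family ::
    "'a::euclidean_space set \<Rightarrow> ('a \<Rightarrow> nat) \<Rightarrow> ('i \<Rightarrow> 'a) \<Rightarrow> bool" where
  "represents_family S m a \<longleftrightarrow>
     range a = S \<and> (\<forall>x\<in>S. finite {k. a k = x} \<and> card {k. a k = x} = m x)"

text \<open>The measure \<open>\<Sum>x\<in>S. m x \<cdot> \<delta>\<^sub>x\<close>: \<open>point_measure\<close> lives on \<open>S\<close>, and
  \<open>distr\<close> extends it to the Borel sets of the whole space.\<close>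

definition mds_measure :: "'a::euclidean_space set \<Rightarrow> ('a \<Rightarrow> nat) \<Rightarrow> 'a measure" where
  "mds_measure S m = distr (point_measure S (\<lambda>x. of_nat (m x))) borel (\<lambda>x. x)"

lemma sets_mds_measure: "sets (mds_measure S m) = sets borel"
  by (simp add: mds_measure_def)

lemma emeasure_mds_measure:
  assumes "B \<in> sets borel" "finite (S \<inter> B)"
  shows "emeasure (mds_measure S m) B = (\<Sum>x\<in>S \<inter> B. of_nat (m x))"
proof -
  have "emeasure (mds_measure S m) B = emeasure (point_measure S (\<lambda>x. of_nat (m x))) (S \<inter> B)"
    using assms(1)
    by (simp add: mds_measure_def emeasure_distr space_point_measure Int_commute)
  also have "\<dots> = (\<Sum>x\<in>S \<inter> B. of_nat (m x))"
    using assms(2) by (intro emeasure_point_measure_finite2) auto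
  finally show ?thesis .
qed

definition almost_periodic_mds :: "'a::euclidean_space set \<Rightarrow> ('a \<Rightarrow> nat) \<Rightarrow> bool" where
  "almost_periodic_mds S m \<longleftrightarrow>
     multiple_discrete_set S m \<and> almost_periodic_measure (mds_measure S m)"

definition vec_of_int :: "int ^ 'p \<Rightarrow> real ^ 'p" where
  "vec_of_int k = (\<chi> i. of_int (k $ i))"

end

(* Write h for an integer vector with F(x + h) uniformly close to F(x). Then
   h \<Gamma> + a_k = a_(k+h) + (F(k) - F(k+h)), so after the reindexing k \<mapsto> k + h the sum
   \<Sum>_k \<phi>(x + a_k) changes little under the translation of x by h \<Gamma>: F is bounded, so the number
   of nonzero terms is bounded independently of x, and \<phi> is uniformly continuous. Such h are
   relatively dense because the translates of F are totally bounded in the uniform norm. *)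
theory Submission
  imports Defs
begin

subsection \<open>Almost periodic functions\<close>

lemma relatively_dense_pos:
  assumes "relatively_dense T"
  obtains R where "R > 0" "\<And>c. \<exists>\<tau>\<in>T. dist c \<tau> < R"
proof -
  obtain R where R: "\<And>c. \<exists>\<tau>\<in>T. \<tau> \<in> ball c R"
    using assms by (auto simp: relatively_dense_def)
  then have "\<exists>\<tau>\<in>T. dist c \<tau> < max R 1" for c
    by (metis mem_ball less_max_iff_disj)
  then show ?thesis
    using that[of "max R 1"] by simp
qed

text \<open>Trades the extended-real supremum for a pointwise bound, which is the form in which
  almost periods are used below.\<close>

lemma almost_periodic_translation:
  assumes "almost_periodic f" "\<epsilon> > 0"
  obtains R where "R > 0" "\<And>c. \<exists>\<tau>. dist c \<tau> < R \<and> (\<forall>x. \<bar>f (x + \<tau>) - f x\<bar> < \<epsilon>)"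
proof -
  let ?T = "{\<tau>. (SUP x. ereal \<bar>f (x + \<tau>) - f x\<bar>) < ereal \<epsilon>}"
  have "relatively_dense ?T"
    using assms by (auto simp: almost_periodic_def)
  then obtain R where R: "R > 0" "\<And>c. \<exists>\<tau>\<in>?T. dist c \<tau> < R"
    using relatively_dense_pos by blast
  have "\<bar>f (x + \<tau>) - f x\<bar> < \<epsilon>" if "\<tau> \<in> ?T" for \<tau> x
  proof -
    have "ereal \<bar>f (x + \<tau>) - f x\<bar> \<le> (SUP x. ereal \<bar>f (x + \<tau>) - f x\<bar>)"
      by (rule SUP_upper) simp
    also have "\<dots> < ereal \<epsilon>"
      using that by simp
    finally show ?thesis by simp
  qed
  then show ?thesis
    using that[OF R(1)] R(2) by blast
qed

lemma almost_periodicI: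
  fixes f :: "'a::euclidean_space \<Rightarrow> real"
  assumes "continuous_on UNIV f"
    and "\<And>\<epsilon>. \<epsilon> > 0 \<Longrightarrow> \<exists>R. \<forall>c. \<exists>\<tau>. dist c \<tau> < R \<and> (\<forall>x. \<bar>f (x + \<tau>) - f x\<bar> \<le> \<epsilon>)"
  shows "almost_periodic f"
  unfolding almost_periodic_def
proof (intro conjI allI impI assms(1))
  fix \<epsilon> :: real assume "\<epsilon> > 0"
  \<comment> \<open>Pointwise bounds control the supremum only non-strictly; halving \<epsilon>
    restores the strict inequality of the definition.\<close>
  then obtain R where R: "\<And>c. \<exists>\<tau>. dist c \<tau> < R \<and> (\<forall>x. \<bar>f (x + \<tau>) - f x\<bar> \<le> \<epsilon> / 2)"
    using assms(2)[of "\<epsilon> / 2"] by auto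
  have "(SUP x. ereal \<bar>f (x + \<tau>) - f x\<bar>) < ereal \<epsilon>"
    if "\<forall>x. \<bar>f (x + \<tau>) - f x\<bar> \<le> \<epsilon> / 2" for \<tau>
  proof -
    have "(SUP x. ereal \<bar>f (x + \<tau>) - f x\<bar>) \<le> ereal (\<epsilon> / 2)"
      using that by (intro SUP_least) simp
    also have "\<dots> < ereal \<epsilon>"
      using \<open>\<epsilon> > 0\<close> by simp
    finally show ?thesis .
  qed
  then show "relatively_dense {\<tau>. (SUP x. ereal \<bar>f (x + \<tau>) - f x\<bar>) < ereal \<epsilon>}"
    unfolding relatively_dense_def mem_ball mem_Collect_eq Bex_def using R by meson
qed

section \<open>Boundedness, uniform continuity and total boundedness of translates\<close>

lemma almost_periodic_imp_continuous_on: "almost_periodic f \<Longrightarrow> continuous_on A f"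
  unfolding almost_periodic_def by (metis continuous_on_subset subset_UNIV)

text \<open>An almost period near \<open>- x\<close> carries \<open>x\<close> into a fixed compact
  ball at a cost below 1, and continuity bounds \<open>f\<close> on that ball.\<close>

lemma almost_periodic_bounded:
  assumes "almost_periodic f"
  shows "bounded (range f)"
proof -
  obtain R where R: "R > 0" "\<And>c. \<exists>\<tau>. dist c \<tau> < R \<and> (\<forall>x. \<bar>f (x + \<tau>) - f x\<bar> < 1)"
    by (rule almost_periodic_translation[OF assms zero_less_one]) blast
  have "bounded (f ` cball 0 R)"
    by (intro compact_imp_bounded compact_continuous_image almost_periodic_imp_continuous_on[OF assms] compact_cball)
  then obtain B where B: "\<And>y. y \<in> cball 0 R \<Longrightarrow> norm (f y) \<le> B"
    unfolding bounded_iff by blast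
  have "norm (f x) \<le> B + 1" for x
  proof -
    obtain \<tau> where \<tau>: "dist (- x) \<tau> < R" "\<bar>f (x + \<tau>) - f x\<bar> < 1"
      using R(2)[of "- x"] by blast
    have "x + \<tau> \<in> cball 0 R"
      using \<tau>(1) norm_minus_cancel[of "x + \<tau>"] by (simp add: dist_norm)
    then show ?thesis
      using B[of "x + \<tau>"] \<tau>(2) by simp
  qed
  then show ?thesis
    by (auto simp: bounded_iff)
qed

text \<open>One almost period near \<open>- x\<close> moves both points into a fixed ball, where
  Heine-Cantor applies; the two moves and the comparison in the ball cost \<open>e / 3\<close>
  each.\<close>

lemma almost_periodic_uniformly_continuous:
  fixes f :: "'a::euclidean_space \<Rightarrow> real"
  assumes "almost_periodic f"
  shows "uniformly_continuous_on UNIV f"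
  unfolding uniformly_continuous_on_def
proof (intro allI impI)
  fix e :: real assume e: "e > 0"
  have "e / 3 > 0"
    using e by simp
  then obtain R where R: "R > 0" "\<And>c. \<exists>\<tau>. dist c \<tau> < R \<and> (\<forall>x. \<bar>f (x + \<tau>) - f x\<bar> < e / 3)"
    by (rule almost_periodic_translation[OF assms]) blast
  \<comment> \<open>The translate of \<open>x\<close> has norm below \<open>R\<close>. The extra 1
    leaves room for the translate of \<open>x'\<close>, whence the bound \<open>min d 1\<close> on
    the distance.\<close>
  have "uniformly_continuous_on (cball 0 (R + 1)) f"
    by (intro compact_uniformly_continuous almost_periodic_imp_continuous_on[OF assms] compact_cball)
  then obtain d where d: "d > 0"
    "\<And>u v. u \<in> cball 0 (R + 1) \<Longrightarrow> v \<in> cball 0 (R + 1) \<Longrightarrow> dist v u < d \<Longrightarrow> dist (f v) (f u) < e / 3"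
    by (rule uniformly_continuous_onE[OF _ \<open>e / 3 > 0\<close>]) blast
  show "\<exists>d>0. \<forall>x\<in>UNIV. \<forall>x'\<in>UNIV. dist x' x < d \<longrightarrow> dist (f x') (f x) < e"
  proof (intro exI[of _ "min d 1"] conjI ballI impI)
    fix x x' :: 'a assume x': "dist x' x < min d 1"
    obtain \<tau> where \<tau>: "dist (- x) \<tau> < R" "\<And>y. \<bar>f (y + \<tau>) - f y\<bar> < e / 3"
      using R(2)[of "- x"] by blast
    have 1: "norm (x + \<tau>) < R"
      using \<tau>(1) norm_minus_cancel[of "x + \<tau>"] by (simp add: dist_norm)
    have "norm (x' + \<tau>) \<le> norm (x + \<tau>) + dist x' x"
      using norm_triangle_ineq[of "x + \<tau>" "x' - x"] by (simp add: dist_norm algebra_simps)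
    then have "dist (f (x' + \<tau>)) (f (x + \<tau>)) < e / 3"
      using 1 x' by (intro d(2)) (simp_all add: dist_norm mem_cball_0 del: mem_cball)
    then show "dist (f x') (f x) < e"
      using \<tau>(2)[of x] \<tau>(2)[of x'] unfolding dist_real_def by linarith
  qed (use d in auto)
qed

lemma uniformly_continuous_UNIV_modulus:
  assumes "uniformly_continuous_on UNIV f" "e > 0"
  shows "\<exists>d>0. \<forall>u v. dist u v < d \<longrightarrow> dist (f u) (f v) < e"
  using assms by (simp add: uniformly_continuous_on_def dist_commute)

text \<open>Subtracting an almost period near \<open>y\<close> reduces the translation vector to one
  in a fixed ball. By uniform continuity, a finite net of that compact ball yields a uniform net of
  the translates.\<close>

lemma almost_periodic_translates_totally_bounded:
  fixes f :: "'a::euclidean_space \<Rightarrow> real"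
  assumes "almost_periodic f" "\<epsilon> > 0"
  shows "\<exists>Y. finite Y \<and> (\<forall>y. \<exists>y'\<in>Y. \<forall>x. \<bar>f (x + y) - f (x + y')\<bar> < \<epsilon>)"
proof -
  have "\<epsilon> / 2 > 0"
    using assms(2) by simp
  then obtain R where R: "R > 0" "\<And>c. \<exists>\<tau>. dist c \<tau> < R \<and> (\<forall>x. \<bar>f (x + \<tau>) - f x\<bar> < \<epsilon> / 2)"
    by (rule almost_periodic_translation[OF assms(1)]) blast
  obtain d where d: "d > 0" "\<And>u v. dist u v < d \<Longrightarrow> dist (f u) (f v) < \<epsilon> / 2"
    using uniformly_continuous_UNIV_modulus[OF almost_periodic_uniformly_continuous[OF assms(1)]
        \<open>\<epsilon> / 2 > 0\<close>] by metis
  have "\<exists>Y. finite Y \<and> Y \<subseteq> cball 0 R \<and> cball (0::'a) R \<subseteq> (\<Union>y\<in>Y. ball y d)"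
    using seq_compact_imp_totally_bounded[OF compact_imp_seq_compact[OF compact_cball],
        rule_format, OF d(1)] .
  then obtain Y where Y: "finite Y" "cball (0::'a) R \<subseteq> (\<Union>y\<in>Y. ball y d)"
    by metis
  have "\<exists>y'\<in>Y. \<forall>x. \<bar>f (x + y) - f (x + y')\<bar> < \<epsilon>" for y
  proof -
    obtain \<tau> where \<tau>: "dist y \<tau> < R" "\<And>x. \<bar>f (x + \<tau>) - f x\<bar> < \<epsilon> / 2"
      using R(2) by blast
    have "y - \<tau> \<in> cball 0 R"
      using \<tau>(1) by (simp add: dist_norm norm_minus_commute)
    then obtain y' where y': "y' \<in> Y" "dist y' (y - \<tau>) < d"
      using Y(2) by auto
    have "\<bar>f (x + y) - f (x + y')\<bar> < \<epsilon>" for x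
    proof -
      have "dist (f (x + y')) (f (x + (y - \<tau>))) < \<epsilon> / 2"
        using y'(2) by (intro d(2)) simp
      moreover have "\<bar>f (x + y) - f (x + (y - \<tau>))\<bar> < \<epsilon> / 2"
        using \<tau>(2)[of "x + (y - \<tau>)"] by (simp add: algebra_simps)
      ultimately show ?thesis
        unfolding dist_real_def by linarith
    qed
    then show ?thesis
      using y'(1) by blast
  qed
  then show ?thesis
    using Y(1) by blast
qed

text \<open>Restricting the translation vectors to \<open>Z\<close> keeps total boundedness, because the centres of
  the net can be chosen in \<open>Z\<close> itself. With \<open>Z\<close> the integer vectors this is what provides
  common \<^emph>\<open>integer\<close> almost periods.\<close>

lemma almost_periodic_family_totally_bounded:
  fixes f :: "'i::finite \<Rightarrow> 'a::euclidean_space \<Rightarrow> real"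
  assumes "\<And>i. almost_periodic (f i)" "\<epsilon> > 0"
  shows "\<exists>H\<subseteq>Z. finite H \<and> (\<forall>h\<in>Z. \<exists>h'\<in>H. \<forall>i x. \<bar>f i (x + h) - f i (x + h')\<bar> < \<epsilon>)"
proof -
  have "\<forall>i. \<exists>Y. finite Y \<and> (\<forall>y. \<exists>y'\<in>Y. \<forall>x. \<bar>f i (x + y) - f i (x + y')\<bar> < \<epsilon> / 2)"
    using almost_periodic_translates_totally_bounded[OF assms(1), of "\<epsilon> / 2"] assms(2) by simp
  then obtain Y where Y: "\<And>i. finite (Y i)"
    "\<And>i y. \<exists>y'\<in>Y i. \<forall>x. \<bar>f i (x + y) - f i (x + y')\<bar> < \<epsilon> / 2"
    by metis
  \<comment> \<open>\<open>c y\<close> records, for every \<open>i\<close>, a net centre that serves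
    \<open>y\<close>. Vectors with equal records are \<epsilon>-close for all \<open>i\<close> at
    once, and only finitely many records exist.\<close>
  define c where "c y i = (SOME y'. y' \<in> Y i \<and> (\<forall>x. \<bar>f i (x + y) - f i (x + y')\<bar> < \<epsilon> / 2))" for y i
  have c: "c y i \<in> Y i" "\<bar>f i (x + y) - f i (x + c y i)\<bar> < \<epsilon> / 2" for i x y
    using someI_ex[OF Y(2)[of i y, unfolded Bex_def]] unfolding c_def by blast+
  have "finite (\<Pi>\<^sub>E i\<in>UNIV. Y i)"
    using Y(1) by (intro finite_PiE) auto
  moreover have "c ` Z \<subseteq> (\<Pi>\<^sub>E i\<in>UNIV. Y i)"
    using c(1) by (auto simp: PiE_iff)
  ultimately have "finite (c ` Z)"
    using finite_subset by blast
  \<comment> \<open>One vector of \<open>Z\<close> is kept for each record attained on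
    \<open>Z\<close>, so the new centres lie in \<open>Z\<close>.\<close>
  then obtain H where H: "H \<subseteq> Z" "finite H" "c ` Z = c ` H"
    using finite_subset_image[of "c ` Z" c Z] by auto
  have "\<exists>h'\<in>H. \<forall>i x. \<bar>f i (x + h) - f i (x + h')\<bar> < \<epsilon>" if "h \<in> Z" for h
  proof -
    obtain h' where h': "h' \<in> H" "c h = c h'"
      using H(3) \<open>h \<in> Z\<close> by blast
    have "\<bar>f i (x + h) - f i (x + h')\<bar> < \<epsilon>" for i x
      using c(2)[of i x h] c(2)[of i x h'] unfolding h'(2) by linarith
    then show ?thesis
      using h'(1) by blast
  qed
  then show ?thesis
    using H by blast
qed

text \<open>For points less than 1 apart, either both lie in \<open>cball 0 (r + 1)\<close>, where
  Heine-Cantor applies, or both values vanish.\<close>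

lemma compact_support_uniformly_continuous:
  fixes \<phi> :: "'a::euclidean_space \<Rightarrow> real"
  assumes "continuous_on UNIV \<phi>" and "\<And>x. \<phi> x \<noteq> 0 \<Longrightarrow> norm x \<le> r"
  shows "uniformly_continuous_on UNIV \<phi>"
  unfolding uniformly_continuous_on_def
proof (intro allI impI)
  fix e :: real assume "e > 0"
  have "uniformly_continuous_on (cball 0 (r + 1)) \<phi>"
    by (intro compact_uniformly_continuous continuous_on_subset[OF assms(1)] compact_cball) simp
  then obtain d where d: "d > 0"
    "\<And>u v. u \<in> cball 0 (r + 1) \<Longrightarrow> v \<in> cball 0 (r + 1) \<Longrightarrow> dist v u < d \<Longrightarrow> dist (\<phi> v) (\<phi> u) < e"
    by (rule uniformly_continuous_onE[OF _ \<open>e > 0\<close>]) blast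
  show "\<exists>d>0. \<forall>x\<in>UNIV. \<forall>x'\<in>UNIV. dist x' x < d \<longrightarrow> dist (\<phi> x') (\<phi> x) < e"
  proof (intro exI[of _ "min d 1"] conjI ballI impI)
    fix x x' :: 'a assume x': "dist x' x < min d 1"
    show "dist (\<phi> x') (\<phi> x) < e"
    proof (cases "norm x \<le> r \<or> norm x' \<le> r")
      case True
      moreover have "norm x' \<le> norm x + dist x' x" "norm x \<le> norm x' + dist x' x"
        using norm_triangle_sub[of x' x] norm_triangle_sub[of x x']
        by (auto simp: dist_norm norm_minus_commute)
      ultimately show ?thesis
        using x' by (intro d(2)) auto
    next
      case False
      then have "\<phi> x = 0" "\<phi> x' = 0"
        using assms(2) by blast+
      then show ?thesis
        using \<open>e > 0\<close> by simp
    qed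
  qed (use d in auto)
qed

subsection \<open>Multiple discrete sets given by families\<close>

lemma integral_mds_measure:
  fixes a :: "'i \<Rightarrow> 'a::euclidean_space" and \<psi> :: "'a \<Rightarrow> real"
  assumes "represents_family S m a" "continuous_on UNIV \<psi>"
    and "finite K" "\<And>k. \<psi> (a k) \<noteq> 0 \<Longrightarrow> k \<in> K"
  shows "(\<integral>t. \<psi> t \<partial>mds_measure S m) = (\<Sum>k\<in>K. \<psi> (a k))"
proof -
  have S: "S = range a" and m: "\<And>x. x \<in> S \<Longrightarrow> finite {k. a k = x}"
    "\<And>x. x \<in> S \<Longrightarrow> card {k. a k = x} = m x"
    using assms(1) by (auto simp: represents_family_def)
  have \<psi>: "\<psi> \<in> borel_measurable borel"
    using assms(2) by (rule borel_measurable_continuous_onI)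
  let ?h = "\<lambda>s. real (m s) * \<psi> s" and ?K' = "{k. \<psi> (a k) \<noteq> 0}"
  have "?K' \<subseteq> K"
    using assms(4) by auto
  then have K': "finite ?K'"
    using assms(3) by (rule finite_subset)
  have sub: "{s \<in> S. ?h s \<noteq> 0} \<subseteq> a ` ?K'"
    using S by auto
  have "(\<integral>t. \<psi> t \<partial>mds_measure S m) = (\<integral>t. \<psi> t \<partial>point_measure S (\<lambda>x. of_nat (m x)))"
    unfolding mds_measure_def using \<psi> by (intro integral_distr) (auto simp: point_measure_def)
  also have "\<dots> = (\<integral>t. ?h t \<partial>count_space S)"
    unfolding point_measure_def
    using integral_density[of \<psi> "count_space S" "\<lambda>x. real (m x)"] by (simp add: ennreal_of_nat_eq_real_of_nat)
  also have "\<dots> = (\<Sum>s | s \<in> S \<and> ?h s \<noteq> 0. ?h s)"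
    using sub K' by (intro lebesgue_integral_count_space_finite_support) (auto intro: finite_subset)
  also have "\<dots> = (\<Sum>s\<in>a ` ?K'. ?h s)"
    using sub K' S by (intro sum.mono_neutral_left) auto
  also have "\<dots> = (\<Sum>s\<in>a ` ?K'. \<Sum>k | k \<in> ?K' \<and> a k = s. \<psi> (a k))"
  proof (rule sum.cong[OF refl])
    fix s assume s: "s \<in> a ` ?K'"
    \<comment> \<open>\<open>\<psi>\<close> is nonzero at \<open>s\<close>, so the whole fibre over
      \<open>s\<close> lies in \<open>?K'\<close>.\<close>
    then have "{k. k \<in> ?K' \<and> a k = s} = {k. a k = s}"
      by auto
    moreover have "(\<Sum>k | a k = s. \<psi> (a k)) = (\<Sum>k | a k = s. \<psi> s)"
      by (rule sum.cong) auto
    ultimately show "?h s = (\<Sum>k | k \<in> ?K' \<and> a k = s. \<psi> (a k))"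
      using m(2)[of s] s S by auto
  qed
  also have "\<dots> = (\<Sum>k\<in>?K'. \<psi> (a k))"
    using K' by (intro sum.group) auto
  also have "\<dots> = (\<Sum>k\<in>K. \<psi> (a k))"
    using assms(3) \<open>?K' \<subseteq> K\<close> by (intro sum.mono_neutral_left) auto
  finally show ?thesis .
qed

text \<open>Fibre sizes serve as multiplicities; a fibre is finite because it maps into a ball
  around its point.\<close>

lemma represents_family_range:
  assumes "\<And>c r. finite {k. a k \<in> ball c r}"
  shows "represents_family (range a) (\<lambda>x. card {k. a k = x}) a"
    and "multiple_discrete_set (range a) (\<lambda>x. card {k. a k = x})"
proof -
  have fin: "finite {k. a k = x}" for x
    using assms[of x 1] by (rule rev_finite_subset) auto
  then show "represents_family (range a) (\<lambda>x. card {k. a k = x}) a"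
    by (auto simp: represents_family_def)
  have "range a \<inter> ball c r = a ` {k. a k \<in> ball c r}" for c r
    by auto
  moreover have "card {k. a k = x} \<ge> 1" if "x \<in> range a" for x
    using fin[of x] that by (auto simp: Suc_le_eq card_gt_0_iff)
  ultimately show "multiple_discrete_set (range a) (\<lambda>x. card {k. a k = x})"
    using assms by (auto simp: multiple_discrete_set_def)
qed

text \<open>The second sum is reindexed by \<open>\<sigma>\<close> and compared termwise with the
  first. At most \<open>N\<close> indices contribute to each sum, and each difference is at most
  \<open>\<eta>\<close>.\<close>

lemma integral_mds_measure_translate:
  fixes a :: "'i \<Rightarrow> 'a::euclidean_space" and \<phi> :: "'a \<Rightarrow> real"
  assumes rep: "represents_family S m a" and cont: "continuous_on UNIV \<phi>"
    and supp: "\<And>x. \<phi> x \<noteq> 0 \<Longrightarrow> norm x < r"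
    and N: "\<And>x. finite {k. norm (x + a k) < r} \<and> card {k. norm (x + a k) < r} \<le> N"
    and \<sigma>: "bij \<sigma>" and close: "\<And>k. dist (\<tau> + a k) (a (\<sigma> k)) < d"
    and unif: "\<And>u v. dist u v < d \<Longrightarrow> dist (\<phi> u) (\<phi> v) \<le> \<eta>"
  shows "\<bar>(\<integral>t. \<phi> (x + \<tau> + t) \<partial>mds_measure S m) - (\<integral>t. \<phi> (x + t) \<partial>mds_measure S m)\<bar>
    \<le> 2 * real N * \<eta>"
proof -
  define K1 where "K1 = {k. norm (x + \<tau> + a k) < r}"
  \<comment> \<open>The indices contributing to the second integral, pulled back along
    \<open>\<sigma>\<close>. Outside \<open>K1 \<union> K2\<close> both matched terms
    vanish.\<close>
  define K2 where "K2 = \<sigma> -` {k. norm (x + a k) < r}"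
  have inj: "inj \<sigma>" and surj: "surj \<sigma>"
    using \<sigma> by (auto simp: bij_def)
  have fin: "finite K1" "finite K2"
    unfolding K1_def K2_def using N inj by (blast intro: finite_vimageI)+
  have card: "card K1 \<le> N" "card K2 \<le> N"
    using N card_vimage_inj[OF inj, of "{k. norm (x + a k) < r}"] surj
    by (auto simp: K1_def K2_def)
  have "(\<integral>t. \<phi> (x + \<tau> + t) \<partial>mds_measure S m) = (\<Sum>k\<in>K1 \<union> K2. \<phi> (x + \<tau> + a k))"
    using fin supp by (intro integral_mds_measure[OF rep])
      (auto simp: K1_def intro!: continuous_intros continuous_on_compose2[OF cont])
  moreover have "(\<integral>t. \<phi> (x + t) \<partial>mds_measure S m) = (\<Sum>k\<in>\<sigma> ` (K1 \<union> K2). \<phi> (x + a k))"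
  proof (intro integral_mds_measure[OF rep])
    fix k assume "\<phi> (x + a k) \<noteq> 0"
    moreover obtain j where "k = \<sigma> j"
      using surj by (metis surjD)
    ultimately show "k \<in> \<sigma> ` (K1 \<union> K2)"
      using supp by (auto simp: K2_def)
  qed (use fin in \<open>auto intro!: continuous_intros continuous_on_compose2[OF cont]\<close>)
  moreover have "(\<Sum>k\<in>\<sigma> ` (K1 \<union> K2). \<phi> (x + a k)) = (\<Sum>k\<in>K1 \<union> K2. \<phi> (x + a (\<sigma> k)))"
    using inj by (subst sum.reindex) (auto intro: inj_on_subset)
  ultimately have "\<bar>(\<integral>t. \<phi> (x + \<tau> + t) \<partial>mds_measure S m) - (\<integral>t. \<phi> (x + t) \<partial>mds_measure S m)\<bar>
      = \<bar>\<Sum>k\<in>K1 \<union> K2. \<phi> (x + \<tau> + a k) - \<phi> (x + a (\<sigma> k))\<bar>"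
    by (simp add: sum_subtractf)
  also have "\<dots> \<le> (\<Sum>k\<in>K1 \<union> K2. \<bar>\<phi> (x + \<tau> + a k) - \<phi> (x + a (\<sigma> k))\<bar>)"
    by (rule sum_abs)
  also have "\<dots> \<le> (\<Sum>k\<in>K1 \<union> K2. \<eta>)"
  proof (rule sum_mono)
    fix k
    have "dist (x + \<tau> + a k) (x + a (\<sigma> k)) < d"
      using close[of k] by (simp add: add.assoc)
    then show "\<bar>\<phi> (x + \<tau> + a k) - \<phi> (x + a (\<sigma> k))\<bar> \<le> \<eta>"
      using unif by (fastforce simp: dist_real_def)
  qed
  also have "\<dots> = real (card (K1 \<union> K2)) * \<eta>"
    by simp
  also have "\<dots> \<le> (2 * real N) * \<eta>"
  proof (rule mult_right_mono)
    have "card (K1 \<union> K2) \<le> 2 * N"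
      using card_Un_le[of K1 K2] card by simp
    then show "real (card (K1 \<union> K2)) \<le> 2 * real N"
      by linarith
    show "\<eta> \<ge> 0"
      using unif[of "\<tau> + a k" "a (\<sigma> k)" for k] close zero_le_dist order_trans by meson
  qed
  finally show ?thesis .
qed

text \<open>A translation that moves the family within \<open>d\<close> of a permutation of itself
  is an almost period of every average, once \<open>d\<close> is small for \<open>\<phi>\<close>.
  The identity permutation with a short translation gives continuity by the same estimate.\<close>

lemma almost_periodic_mdsI:
  fixes a :: "'i \<Rightarrow> 'a::euclidean_space"
  assumes rep: "represents_family S m a" and mds: "multiple_discrete_set S m"
    and N: "\<And>r. \<exists>N. \<forall>x. finite {k. norm (x + a k) < r} \<and> card {k. norm (x + a k) < r} \<le> N"
    and ap: "\<And>d. d > 0 \<Longrightarrow>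
      \<exists>R. \<forall>c. \<exists>\<tau> \<sigma>. dist c \<tau> < R \<and> bij \<sigma> \<and> (\<forall>k. dist (\<tau> + a k) (a (\<sigma> k)) < d)"
  shows "almost_periodic_mds S m"
proof -
  have "emeasure (mds_measure S m) K < \<infinity>" if "compact K" for K
  proof -
    have "bounded K" and "K \<in> sets borel"
      using that by (auto simp: compact_imp_bounded intro: borel_compact)
    then obtain r where "K \<subseteq> ball 0 r"
      using bounded_subset_ballD by blast
    then have "finite (S \<inter> K)"
      using mds unfolding multiple_discrete_set_def
      by (metis Int_mono finite_subset order_refl)
    then show ?thesis
      using \<open>K \<in> sets borel\<close> by (simp add: emeasure_mds_measure of_nat_less_top flip: of_nat_sum)
  qed
  moreover have "almost_periodic (\<lambda>x. \<integral>t. \<phi> (x + t) \<partial>mds_measure S m)" (is "almost_periodic ?g")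
    if cont: "continuous_on UNIV \<phi>" and "compact (closure {x. \<phi> x \<noteq> 0})" for \<phi> :: "'a \<Rightarrow> real"
  proof -
    have "bounded {x. \<phi> x \<noteq> 0}"
      using that(2) bounded_subset[OF compact_imp_bounded closure_subset] by blast
    then obtain r where "{x. \<phi> x \<noteq> 0} \<subseteq> ball 0 r"
      using bounded_subset_ballD by blast
    then have supp: "norm x < r" if "\<phi> x \<noteq> 0" for x
      using that by auto
    obtain N where N: "\<And>x. finite {k. norm (x + a k) < r} \<and> card {k. norm (x + a k) < r} \<le> N"
      using N by metis
    have "uniformly_continuous_on UNIV \<phi>"
      using compact_support_uniformly_continuous[OF cont, of r] supp by (meson less_imp_le)
    \<comment> \<open>\<open>d\<close> is uniform in \<open>\<tau>\<close>, \<open>\<sigma>\<close>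
      and \<open>x\<close>, so the estimate serves both continuity and almost periods.\<close>
    have key: "\<exists>d>0. \<forall>\<tau> \<sigma>. bij \<sigma> \<and> (\<forall>k. dist (\<tau> + a k) (a (\<sigma> k)) < d)
        \<longrightarrow> (\<forall>x. \<bar>?g (x + \<tau>) - ?g x\<bar> \<le> \<epsilon>)" if "\<epsilon> > 0" for \<epsilon>
    proof -
      \<comment> \<open>The added 1 keeps the denominator positive when
        \<open>N = 0\<close>.\<close>
      define \<eta> where "\<eta> = \<epsilon> / (2 * real N + 1)"
      have "\<eta> > 0" and le: "2 * real N * \<eta> \<le> \<epsilon>"
        using \<open>\<epsilon> > 0\<close> by (auto simp: \<eta>_def field_simps)
      obtain d where d: "d > 0" "\<And>u v. dist u v < d \<Longrightarrow> dist (\<phi> u) (\<phi> v) < \<eta>"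
        using uniformly_continuous_UNIV_modulus[OF \<open>uniformly_continuous_on UNIV \<phi>\<close> \<open>\<eta> > 0\<close>]
        by metis
      have "\<bar>?g (x + \<tau>) - ?g x\<bar> \<le> \<epsilon>"
        if "bij \<sigma>" "\<forall>k. dist (\<tau> + a k) (a (\<sigma> k)) < d" for \<tau> \<sigma> x
        using integral_mds_measure_translate[OF rep cont supp N that(1), of \<tau> d \<eta> x] that(2) d(2) le
        by (meson less_imp_le order_trans)
      then show ?thesis
        using d(1) by blast
    qed
    have "uniformly_continuous_on UNIV ?g"
      unfolding uniformly_continuous_on_def
    proof (intro allI impI)
      fix e :: real assume "e > 0"
      then obtain d where d: "d > 0" "\<And>\<tau> \<sigma> x. bij \<sigma> \<Longrightarrow> (\<And>k. dist (\<tau> + a k) (a (\<sigma> k)) < d) \<Longrightarrow>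
          \<bar>?g (x + \<tau>) - ?g x\<bar> \<le> e / 2"
        using key[of "e / 2"] by auto
      have "dist (?g x') (?g x) < e" if "dist x' x < d" for x x'
        using d(2)[of id "x' - x" x] that \<open>e > 0\<close> by (simp add: dist_norm)
      then show "\<exists>d>0. \<forall>x\<in>UNIV. \<forall>x'\<in>UNIV. dist x' x < d \<longrightarrow> dist (?g x') (?g x) < e"
        using d(1) by blast
    qed
    then show ?thesis
      using key ap by (intro almost_periodicI uniformly_continuous_imp_continuous) (assumption, metis)
  qed
  ultimately show ?thesis
    using mds by (simp add: almost_periodic_mds_def almost_periodic_measure_def sets_mds_measure)
qed

subsection \<open>Integer vectors\<close>

lemma vec_of_int_add: "vec_of_int (h + k) = vec_of_int h + vec_of_int k"
  and vec_of_int_diff: "vec_of_int (h - k) = vec_of_int h - vec_of_int k"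
  by (simp_all add: vec_of_int_def vec_eq_iff)

lemma finite_bounded_int_vectors: "finite {k :: int ^ 'p. \<forall>i. \<bar>k $ i\<bar> \<le> M}"
proof (rule finite_subset)
  show "{k :: int ^ 'p. \<forall>i. \<bar>k $ i\<bar> \<le> M} \<subseteq> vec_lambda ` (\<Pi>\<^sub>E i\<in>UNIV. {- M..M})"
  proof
    fix k :: "int ^ 'p" assume "k \<in> {k. \<forall>i. \<bar>k $ i\<bar> \<le> M}"
    then show "k \<in> vec_lambda ` (\<Pi>\<^sub>E i\<in>UNIV. {- M..M})"
      by (intro image_eqI[of _ _ "vec_nth k"]) (auto simp: PiE_iff abs_le_iff minus_le_iff)
  qed
qed (auto intro!: finite_PiE)

text \<open>Any two such integer vectors differ by less than \<open>2 * \<rho>\<close> in norm, so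
  all of them lie in a translate of one finite box \<open>?B\<close> whose size does not depend on
  \<open>c\<close>.\<close>

lemma int_vectors_near_bounded:
  "\<exists>N. \<forall>c. finite {k :: int ^ 'p. norm (c + vec_of_int k) < \<rho>} \<and>
    card {k :: int ^ 'p. norm (c + vec_of_int k) < \<rho>} \<le> N"
proof (intro exI allI)
  fix c :: "real ^ 'p"
  let ?A = "{k :: int ^ 'p. norm (c + vec_of_int k) < \<rho>}"
    and ?B = "{k :: int ^ 'p. \<forall>i. \<bar>k $ i\<bar> \<le> \<lceil>2 * \<rho>\<rceil>}"
  have "\<exists>k0. ?A \<subseteq> (\<lambda>j. j + k0) ` ?B"
  proof (cases "?A = {}")
    case False
    then obtain k0 where k0: "k0 \<in> ?A" by blast
    have "k - k0 \<in> ?B" if "k \<in> ?A" for k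
    proof -
      have "norm (vec_of_int (k - k0)) < 2 * \<rho>"
        using norm_triangle_ineq4[of "c + vec_of_int k" "c + vec_of_int k0"] k0 that
        by (simp add: vec_of_int_diff)
      then have "\<bar>vec_of_int (k - k0) $ i\<bar> \<le> 2 * \<rho>" for i
        using component_le_norm_cart[of "vec_of_int (k - k0)" i] by linarith
      then have "real_of_int \<bar>k $ i - k0 $ i\<bar> \<le> 2 * \<rho>" for i
        by (simp add: vec_of_int_def)
      then have "real_of_int \<bar>k $ i - k0 $ i\<bar> \<le> of_int \<lceil>2 * \<rho>\<rceil>" for i
        using order_trans[OF _ le_of_int_ceiling] by blast
      then show ?thesis
        unfolding of_int_le_iff by simp
    qed
    then have "?A \<subseteq> (\<lambda>j. j + k0) ` ?B"
      by (metis (no_types, lifting) diff_add_cancel image_eqI subsetI)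
    then show ?thesis ..
  qed auto
  then obtain k0 where k0: "?A \<subseteq> (\<lambda>j. j + k0) ` ?B" ..
  have "finite ?B"
    by (rule finite_bounded_int_vectors)
  with k0 show "finite ?A \<and> card ?A \<le> card ?B"
    by (meson surj_card_le finite_surj)
qed

text \<open>Rounding each coordinate down leaves errors below 1, and the norm is at most the sum of
  the coordinate errors.\<close>

lemma int_vector_near:
  fixes c :: "real ^ 'p"
  shows "\<exists>h. norm (c - vec_of_int h) \<le> real CARD('p)"
proof (intro exI)
  let ?h = "\<chi> i. \<lfloor>c $ i\<rfloor>"
  have "norm (c - vec_of_int ?h) \<le> (\<Sum>i\<in>UNIV. \<bar>(c - vec_of_int ?h) $ i\<bar>)"
    by (rule norm_le_l1_cart)
  also have "\<dots> \<le> (\<Sum>i\<in>(UNIV :: 'p set). 1)"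
    by (intro sum_mono) (simp add: vec_of_int_def, linarith)
  finally show "norm (c - vec_of_int ?h) \<le> real CARD('p)"
    by simp
qed

section \<open>The perturbed lattice\<close>

lemma vector_matrix_mult_norm_bound:
  fixes A :: "real ^ 'n ^ 'm"
  obtains C where "C > 0" "\<And>x. norm (x v* A) \<le> C * norm x"
proof -
  \<comment> \<open>Right multiplication of a row vector by \<open>A\<close> is left multiplication
    by the transpose, a bounded linear map.\<close>
  have "bounded_linear ((*v) (transpose A))"
    by (rule matrix_vector_mul_bounded_linear)
  then obtain C where "C > 0" "\<And>x. norm (transpose A *v x) \<le> norm x * C"
    using bounded_linear.pos_bounded by blast
  then show ?thesis
    using that[of C] by (simp add: mult.commute)
qed

theorem mainTheorem1:
  fixes \<Gamma> :: "real ^ 'p ^ 'p"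
    and F :: "real ^ 'p \<Rightarrow> real ^ 'p"
    and a :: "int ^ 'p \<Rightarrow> real ^ 'p"
  assumes "invertible \<Gamma>"
    and "\<And>j. almost_periodic (\<lambda>x. F x $ j)"
    and "\<And>k. a k = vec_of_int k v* \<Gamma> + F (vec_of_int k)"
  shows "\<exists>S m. represents_family S m a \<and> almost_periodic_mds S m"
proof -
  obtain \<Delta> where \<Delta>: "\<Gamma> ** \<Delta> = mat 1" "\<Delta> ** \<Gamma> = mat 1"
    using assms(1) by (auto simp: invertible_def)
  have add: "(x + y) v* A = x v* A + y v* A" and diff: "(x - y) v* A = x v* A - y v* A"
    for x y :: "real ^ 'p" and A :: "real ^ 'p ^ 'p"
    by (simp_all add: matrix_vector_right_distrib matrix_vector_mult_diff_distrib
        flip: transpose_matrix_vector)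
  have inv: "x v* \<Gamma> v* \<Delta> = x" "x v* \<Delta> v* \<Gamma> = x" for x
    by (simp_all add: vector_matrix_mul_assoc \<Delta>)
  obtain C where C: "C > 0" "\<And>x. norm (x v* \<Gamma>) \<le> C * norm x"
    using vector_matrix_mult_norm_bound by blast
  obtain D where D: "D > 0" "\<And>x. norm (x v* \<Delta>) \<le> D * norm x"
    using vector_matrix_mult_norm_bound by blast

  have "\<exists>B. \<forall>x. \<bar>F x $ j\<bar> \<le> B" for j
    using almost_periodic_bounded[OF assms(2)[of j]] by (auto simp: bounded_iff)
  then obtain B where B: "\<And>j x. \<bar>F x $ j\<bar> \<le> B j"
    by metis
  have F: "norm (F x) \<le> sum B UNIV" for x
    using norm_le_l1_cart[of "F x"] sum_mono[of UNIV "\<lambda>j. \<bar>F x $ j\<bar>" B] B by force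

  have count: "\<exists>N. \<forall>x. finite {k. norm (x + a k) < r} \<and> card {k. norm (x + a k) < r} \<le> N" for r
  proof -
    \<comment> \<open>Removing \<open>F\<close> enlarges the radius \<open>r\<close> by at most
      \<open>sum B UNIV\<close>; applying the inverse matrix \<open>\<Delta>\<close> scales it by at
      most \<open>D\<close>.\<close>
    let ?\<rho> = "D * (r + sum B UNIV)"
    obtain N where N: "\<And>c. finite {k :: int ^ 'p. norm (c + vec_of_int k) < ?\<rho>}"
      "\<And>c. card {k :: int ^ 'p. norm (c + vec_of_int k) < ?\<rho>} \<le> N"
      using int_vectors_near_bounded by metis
    have "{k. norm (x + a k) < r} \<subseteq> {k. norm (x v* \<Delta> + vec_of_int k) < ?\<rho>}" for x
    proof safe
      fix k assume "norm (x + a k) < r"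
      then have "norm (x + vec_of_int k v* \<Gamma>) < r + sum B UNIV"
        using norm_triangle_ineq4[of "x + a k" "F (vec_of_int k)"] F[of "vec_of_int k"]
        by (simp add: assms(3) algebra_simps)
      then have "norm ((x + vec_of_int k v* \<Gamma>) v* \<Delta>) < ?\<rho>"
        using D by (meson le_less_trans mult_strict_left_mono)
      then show "norm (x v* \<Delta> + vec_of_int k) < ?\<rho>"
        by (simp add: add inv)
    qed
    then show ?thesis
      using N by (meson card_mono finite_subset order_trans)
  qed

  have periods: "\<exists>R. \<forall>c. \<exists>\<tau> \<sigma>. dist c \<tau> < R \<and> bij \<sigma> \<and> (\<forall>k. dist (\<tau> + a k) (a (\<sigma> k)) < d)"
    if "d > 0" for d
  proof -
    \<comment> \<open>Chosen so that coordinate errors of at most \<open>e\<close> add up to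
      strictly less than \<open>d\<close>.\<close>
    define e where "e = d / (real CARD('p) + 1)"
    have e: "e > 0" "real CARD('p) * e < d"
      using that by (auto simp: e_def field_simps)
    obtain H where H: "H \<subseteq> range (vec_of_int :: int ^ 'p \<Rightarrow> _)" "finite H"
      "\<And>h :: int ^ 'p. \<exists>h'\<in>H. \<forall>j x. \<bar>F (x + vec_of_int h) $ j - F (x + h') $ j\<bar> < e"
      using almost_periodic_family_totally_bounded[of "\<lambda>j x. F x $ j", OF assms(2) e(1),
          of "range (vec_of_int :: int ^ 'p \<Rightarrow> _)"] by blast
    obtain M where M: "\<And>h. h \<in> H \<Longrightarrow> norm h \<le> M"
      using finite_imp_bounded[OF H(2)] by (auto simp: bounded_iff)
    show ?thesis
    proof (rule exI, rule allI)
      fix c :: "real ^ 'p"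
      \<comment> \<open>\<open>h0\<close> approximates \<open>c\<close> in lattice coordinates, and
        \<open>h1\<close> is its representative in the finite net \<open>H\<close>. Since
        translating \<open>F\<close> by \<open>h0\<close> or by \<open>h1\<close> gives nearly the
        same mapping, \<open>h0 - h1\<close> is an integer almost period, displaced from
        \<open>h0\<close> by at most \<open>M\<close>.\<close>
      obtain h0 where h0: "norm (c v* \<Delta> - vec_of_int h0) \<le> real CARD('p)"
        using int_vector_near by blast
      obtain h1 where h1: "vec_of_int h1 \<in> H"
        "\<And>j x. \<bar>F (x + vec_of_int h0) $ j - F (x + vec_of_int h1) $ j\<bar> < e"
        using H(1) H(3)[of h0] by (metis imageE subsetD)
      define h where "h = h0 - h1"
      have "norm (c v* \<Delta> - vec_of_int h) \<le> norm (c v* \<Delta> - vec_of_int h0) + norm (vec_of_int h1)"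
        using norm_triangle_ineq[of "c v* \<Delta> - vec_of_int h0" "vec_of_int h1"]
        by (simp add: h_def vec_of_int_diff algebra_simps)
      \<comment> \<open>The summand 1 makes the bound strict.\<close>
      then have "norm (c v* \<Delta> - vec_of_int h) < real CARD('p) + M + 1"
        using h0 M[OF h1(1)] by simp
      then have "norm ((c v* \<Delta> - vec_of_int h) v* \<Gamma>) < C * (real CARD('p) + M + 1)"
        using C by (meson le_less_trans mult_strict_left_mono)
      then have 1: "dist c (vec_of_int h v* \<Gamma>) < C * (real CARD('p) + M + 1)"
        by (simp add: diff inv dist_norm)
      have 2: "dist (vec_of_int h v* \<Gamma> + a k) (a (k + h)) < d" for k
      proof -
        let ?v = "F (vec_of_int k) - F (vec_of_int (k + h))"
        have "\<bar>?v $ j\<bar> \<le> e" for j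
          \<comment> \<open>Evaluating at \<open>k - h1\<close> turns the two translates into
            \<open>F\<close> at \<open>k + h\<close> and at \<open>k\<close>.\<close>
          using h1(2)[of "vec_of_int k - vec_of_int h1" j]
          by (simp add: h_def vec_of_int_add vec_of_int_diff algebra_simps)
        then have "(\<Sum>j\<in>UNIV. \<bar>?v $ j\<bar>) \<le> (\<Sum>j\<in>(UNIV :: 'p set). e)"
          by (intro sum_mono)
        then have "norm ?v < d"
          using norm_le_l1_cart[of ?v] e(2) by simp
        \<comment> \<open>The lattice parts cancel exactly, leaving only the variation of
          \<open>F\<close>.\<close>
        moreover have "vec_of_int h v* \<Gamma> + a k - a (k + h) = ?v"
          by (simp add: assms(3) vec_of_int_add add)
        ultimately show ?thesis
          by (simp add: dist_norm)
      qed
      have "bij (\<lambda>k. k + h)"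
        by (rule bij_betw_byWitness[of _ "\<lambda>k. k - h"]) auto
      with 1 2 show "\<exists>\<tau> \<sigma>. dist c \<tau> < C * (real CARD('p) + M + 1) \<and> bij \<sigma> \<and>
          (\<forall>k. dist (\<tau> + a k) (a (\<sigma> k)) < d)"
        by blast
    qed
  qed

  \<comment> \<open>Local finiteness is the counting bound taken at \<open>x = - c\<close>.\<close>
  have "{k. a k \<in> ball c r} = {k. norm (- c + a k) < r}" for c r
    by (simp add: dist_norm norm_minus_commute)
  then have "finite {k. a k \<in> ball c r}" for c r
    using count by metis
  note fam = represents_family_range[OF this]
  show ?thesis
    using fam(1) almost_periodic_mdsI[OF fam count periods] by blast
qed

end
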